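(* As formal power series in $q$, $$\sum_{n\ge0}q^n\sum_{\lambda\vdash n}\prod_{u\in\lambda}\frac{(c_{sp}^{\lambda}(u))^2-1}{(h^{\lambda}(u))^2}=\prod_{j\ge1}\frac{1-q^j}{1-q^{4j-2}}=\sum_{n\ge0}(-q)^{\binom{n+1}2}.$$
   Context: For a partition $\lambda$ with conjugate $\lambda'$ (cells $(i,j)$ = row $i$, column $j$ of the Young diagram; $\lambda_i=0$ beyond the length): hook length $h^\lambda(i,j)=\lambda_i+\lambda'_j-i-j+1$; symplectic content $c^\lambda_{sp}(i,j)=\lambda_i+\lambda_j-i-j+2$ if $i>j$ and $c^\lambda_{sp}(i,j)=i+j-\lambda'_i-\lambda'_j$ if $i\le j$. The empty partition contributes the empty product $1$ for $n=0$. *)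

theory Defs
  imports "HOL-Analysis.Infinite_Products" "HOL-Computational_Algebra.Formal_Power_Series"
begin

text \<open>
  A partition of \<open>n\<close> is the list of its parts, all positive and in weakly decreasing order.
  Rows and columns are numbered from 1, as is usual for Young diagrams.
\<close>

definition partitions :: "nat \<Rightarrow> nat list set" where
  "partitions n = {l. sorted_wrt (\<ge>) l \<and> (\<forall>p\<in>set l. 0 < p) \<and> sum_list l = n}"

definition part :: "nat list \<Rightarrow> nat \<Rightarrow> nat" where
  "part l i = (if 1 \<le> i \<and> i \<le> length l then l ! (i - 1) else 0)"

text \<open>The \<open>j\<close>-th part of the conjugate partition, for \<open>j \<ge> 1\<close>.\<close>

definition conj_part :: "nat list \<Rightarrow> nat \<Rightarrow> nat" where
  "conj_part l j = card {i. 1 \<le> i \<and> i \<le> length l \<and> j \<le> part l i}"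

definition cells :: "nat list \<Rightarrow> (nat \<times> nat) set" where
  "cells l = {(i, j). 1 \<le> i \<and> i \<le> length l \<and> 1 \<le> j \<and> j \<le> part l i}"

definition hook_length :: "nat list \<Rightarrow> nat \<times> nat \<Rightarrow> int" where
  "hook_length l = (\<lambda>(i, j). int (part l i) + int (conj_part l j) - int i - int j + 1)"

definition sp_content :: "nat list \<Rightarrow> nat \<times> nat \<Rightarrow> int" where
  "sp_content l = (\<lambda>(i, j).
     if i > j then int (part l i) + int (part l j) - int i - int j + 2
     else int i + int j - int (conj_part l i) - int (conj_part l j))"

text \<open>Sums over the partitions of \<open>n\<close> and products over the cells of a diagram are over finite sets, so
  they are not the default values
  \<open>0\<close> and \<open>1\<close> that \<open>sum\<close> and \<open>prod\<close> take on infinite ones.\<close>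

lemma finite_partitions: "finite (partitions n)"
proof (rule finite_subset)
  show "partitions n \<subseteq> {l. set l \<subseteq> {..n} \<and> length l \<le> n}"
  proof safe
    fix l x assume l: "l \<in> partitions n"
    show "x \<le> n" if "x \<in> set l"
      using l that member_le_sum_list[of x l] by (auto simp: partitions_def)
    have "length l \<le> sum_list l" if "\<forall>p\<in>set l. 0 < p" for l :: "nat list"
      using that by (induction l) auto
    with l show "length l \<le> n" by (auto simp: partitions_def)
  qed
  show "finite {l. set l \<subseteq> {..n} \<and> length l \<le> n}"
    by (rule finite_lists_length_le) simp
qed

lemma finite_cells: "finite (cells l)"
proof -
  have "cells l = Sigma {1..length l} (\<lambda>i. {1..part l i})"
    by (auto simp: cells_def)
  thus ?thesis by simp
qed

end

theory Submission
  imports Defs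
begin

text \<open>
  Symplectic contents do not change when the first row and the first column of a diagram are
  removed. By induction the only diagrams without a cell of symplectic content \<open>\<plusminus>1\<close> are hence the
  staircases \<open>(m, m - 1, \<dots>, 1)\<close>, so only the partitions of triangular numbers into a staircase
  contribute to the first series. On a staircase, hook lengths and symplectic contents
  are constant along each half of an antidiagonal, and the product telescopes to a sign.
  The second equality is Gauss's identity for triangular numbers at \<open>-q\<close>. It follows from a finite
  identity of Shanks, one side of which agrees with a partial product modulo \<open>q ^ (2 * n + 1)\<close>.
\<close>

section \<open>Diagrams without symplectic contents \<open>\<plusminus>1\<close>\<close>

text \<open>Rows and columns are numbered from 0 here: \<open>p i\<close> is the length of row \<open>i\<close>
  and \<open>p' j\<close> that of column \<open>j\<close>.\<close>

lemma staircase_if_no_unit_content: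
  fixes p p' :: "nat \<Rightarrow> nat"
  assumes conj: "\<And>i j. j < p i \<longleftrightarrow> i < p' j"
    and no_unit: "\<And>i j. j < p i \<Longrightarrow>
      (if j < i then int (p i) + int (p j) - int i - int j
       else int i + int j + 2 - int (p' i) - int (p' j)) \<notin> {1, -1}"
  shows "\<exists>m. \<forall>i. p i = m - i"
  using assms
proof (induction "p 0" arbitrary: p p' rule: less_induct)
  case less
  note conj = less.prems(1) and no_unit = less.prems(2)
  show ?case
  proof (cases "p 0 = 0")
    case True
    have "p i = 0" for i
      using True conj[of 0 i] conj[of 0 0] by simp
    thus ?thesis by (intro exI[of _ 0]) simp
  next
    case False
    have antimono: "p (Suc i) \<le> p i" for i
      using conj by (metis Suc_lessD leI less_irrefl)
    have "p (Suc 0) - 1 < p 0"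
      using antimono[of 0] False by linarith
    moreover have "j < p (Suc i) - 1 \<longleftrightarrow> i < p' (Suc j) - 1" for i j
      using conj[of "Suc j" "Suc i"] by linarith
    moreover have "(if j < i then int (p (Suc i) - 1) + int (p (Suc j) - 1) - int i - int j
       else int i + int j + 2 - int (p' (Suc i) - 1) - int (p' (Suc j) - 1)) \<notin> {1, -1}"
      if "j < p (Suc i) - 1" for i j
    proof (cases "j < i")
      case True
      \<comment> \<open>A cell below the diagonal forces the diagonal cell of its column into the
        diagram, so no subtraction truncates and the content is that of the larger diagram. The
        other half uses column lengths in the same way.\<close>
      moreover have "Suc j < p (Suc j)"
        using that True conj[of "Suc j" "Suc i"] conj[of "Suc j" "Suc j"] by linarith
      ultimately show ?thesis
        using no_unit[of "Suc j" "Suc i"] that by (auto simp: of_nat_diff)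
    next
      case False
      moreover have "Suc i < p' (Suc j)"
        using that conj[of "Suc j" "Suc i"] by linarith
      moreover have "Suc i < p' (Suc i)"
        using that False conj[of "Suc i" "Suc i"] by linarith
      ultimately show ?thesis
        using no_unit[of "Suc j" "Suc i"] that by (auto simp: of_nat_diff)
    qed
    ultimately obtain m where m: "\<And>i. p (Suc i) - 1 = m - i"
      using less.hyps[of "\<lambda>i. p (Suc i) - 1" "\<lambda>j. p' (Suc j) - 1"] by blast
    have m': "p' (Suc j) - 1 = m - j" for j
    proof -
      have "i < p' (Suc j) - 1 \<longleftrightarrow> i < m - j" for i
        using m[of i] conj[of "Suc j" "Suc i"] by linarith
      from this[of "p' (Suc j) - 1"] this[of "m - j"] show ?thesis by linarith
    qed
    define a b where "a = p 0" and "b = p' 0"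
    \<comment> \<open>Rows and columns past the inner staircase have at most one cell, and it lies
      in the first column or the first row. Only the lengths \<open>a\<close> and \<open>b\<close>
      of the latter remain free.\<close>
    have row: "p (Suc i) = (if i < m then m + 1 - i else if Suc i < b then 1 else 0)" for i
      using m[of i] conj[of 0 "Suc i"] unfolding b_def by auto
    have col: "p' (Suc j) = (if j < m then m + 1 - j else if Suc j < a then 1 else 0)" for j
      using m'[of j] conj[of "Suc j" 0] unfolding a_def by auto
    have am: "m < a" and bm: "m < b"
      using False conj[of 0 0] row[of 0] col[of 0] antimono[of 0] conj[of 0 m]
        row[of "m - 1"] col[of "m - 1"] conj[of m 0] unfolding a_def b_def
      by (cases m; simp)+
    have c1: "int (p (Suc i)) + int a - int (Suc i) \<notin> {1, -1}" if "Suc i < b" for i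
      using no_unit[of 0 "Suc i"] conj[of 0 "Suc i"] that by (simp add: a_def b_def)
    have c2: "int (Suc j) + 2 - int b - int (p' (Suc j)) \<notin> {1, -1}" if "Suc j < a" for j
      using no_unit[of "Suc j" 0] that by (simp add: a_def b_def)
    \<comment> \<open>Forbidden cells: \<open>(a, 0)\<close> has content 1 if \<open>a < b\<close>;
      \<open>(0, b - 2)\<close> has content -1 if \<open>m + 3 \<le> b \<le> a\<close>;
      \<open>(0, b)\<close> has content 1 if \<open>b < a\<close>; \<open>(0, m)\<close> has content
      -1 if \<open>a = b = m + 1 > 1\<close>. What survives is a single cell or a staircase whose
      size has grown from \<open>m\<close> to \<open>m + 2\<close>.\<close>
    consider (col) "a < b" "m + 2 \<le> b" | (row) "m + 2 \<le> a" "b \<le> a" "b \<noteq> m + 2 \<or> m + 3 \<le> a"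
      | (rect) "a = m + 1" "b = m + 1" | (stair) "a = m + 2" "b = m + 2"
      using am bm by linarith
    thus ?thesis
    proof cases
      case col
      have "p (Suc (a - 1)) = 1"
        using row[of "a - 1"] am col by auto
      thus ?thesis using c1[of "a - 1"] am col by simp
    next
      case row
      show ?thesis
      proof (cases "m + 3 \<le> b")
        case True
        have "p' (Suc (b - 3)) = 1"
          using True row col[of "b - 3"] by auto
        moreover have "Suc (b - 3) < a" using True row by linarith
        ultimately show ?thesis using c2[of "b - 3"] True by (simp add: of_nat_diff)
      next
        case False
        hence "b < a" using row bm by linarith
        moreover have "p' (Suc (b - 1)) = 1"
          using \<open>b < a\<close> bm col[of "b - 1"] by auto
        ultimately show ?thesis using c2[of "b - 1"] bm by (simp add: of_nat_diff)
      qed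
    next
      case rect
      show ?thesis
      proof (cases m)
        case 0
        have "p i = 1 - i" for i
          using row[of "i - 1"] rect 0 by (cases i) (auto simp: a_def)
        thus ?thesis by blast
      next
        case (Suc k)
        thus ?thesis using c2[of "m - 1"] col[of "m - 1"] rect by simp
      qed
    next
      case stair
      have "p i = (m + 2) - i" for i
        using row[of "i - 1"] stair by (cases i) (auto simp: a_def)
      thus ?thesis by blast
    qed
  qed
qed

section \<open>Partitions\<close>

text \<open>Since \<open>l\<close> decreases, the rows of length at least \<open>j\<close> form an
  initial segment, and \<open>conj_part l j\<close> is its size.\<close>

lemma le_part_iff_le_conj_part:
  assumes "sorted_wrt (\<ge>) l" "1 \<le> i" "1 \<le> j"
  shows "j \<le> part l i \<longleftrightarrow> i \<le> conj_part l j"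
proof -
  let ?I = "{i. 1 \<le> i \<and> i \<le> length l \<and> j \<le> part l i}"
  have fin: "finite ?I" by (rule finite_subset[of _ "{..length l}"]) auto
  have down: "k \<in> ?I" if "i \<in> ?I" "1 \<le> k" "k \<le> i" for i k
  proof (cases "k = i")
    case False
    with that have "l ! (i - 1) \<le> l ! (k - 1)"
      using assms(1) by (auto simp: sorted_wrt_iff_nth_less)
    with that show ?thesis by (auto simp: part_def)
  qed (use that in simp)
  show ?thesis
  proof
    assume "j \<le> part l i"
    hence "i \<in> ?I" using assms by (auto simp: part_def split: if_splits)
    hence "{1..i} \<subseteq> ?I" using down by auto
    from card_mono[OF fin this] show "i \<le> conj_part l j" by (simp add: conj_part_def)
  next
    assume "i \<le> conj_part l j"
    show "j \<le> part l i"
    proof (rule ccontr)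
      assume "\<not> j \<le> part l i"
      hence "i \<notin> ?I" by simp
      hence "?I \<subseteq> {1..<i}" using down[of _ i] assms(2)
        by (metis (mono_tags, lifting) atLeastLessThan_iff mem_Collect_eq not_less subsetI)
      from card_mono[OF _ this] have "card ?I \<le> i - 1" by simp
      with \<open>i \<le> conj_part l j\<close> assms(2) show False by (simp add: conj_part_def)
    qed
  qed
qed

section \<open>Staircases and the product over their cells\<close>

lemma part_staircase: "1 \<le> i \<Longrightarrow> part (rev [1..<Suc m]) i = m + 1 - i"
  by (auto simp: part_def rev_nth simp del: upt_Suc)

lemma conj_part_staircase: "1 \<le> j \<Longrightarrow> conj_part (rev [1..<Suc m]) j = m + 1 - j"
proof -
  assume "1 \<le> j"
  hence "{i. 1 \<le> i \<and> i \<le> length (rev [1..<Suc m]) \<and> j \<le> part (rev [1..<Suc m]) i} = {1..m + 1 - j}"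
    using part_staircase by (auto simp del: upt_Suc)
  thus ?thesis unfolding conj_part_def by simp
qed

lemma sum_list_staircase: "sum_list (rev [1..<Suc m]) = Suc m choose 2"
  by (induction m) (simp_all add: numeral_2_eq_2)

lemma staircase_in_partitions: "rev [1..<Suc m] \<in> partitions (Suc m choose 2)"
  using sum_list_staircase[of m]
  by (auto simp: partitions_def sorted_wrt_rev simp del: upt_Suc
      intro: sorted_wrt_mono_rel[OF _ sorted_upt])

text \<open>\<open>part\<close> is 0 beyond the length and cannot see trailing zeros; positivity of
  the entries is what fixes the length.\<close>

lemma eq_staircaseI:
  assumes pos: "\<forall>x\<in>set l. 0 < x" and part: "\<And>i. part l (Suc i) = m - i"
  shows "l = rev [1..<Suc m]"
proof (rule nth_equalityI)
  have "i < length l \<longleftrightarrow> i < m" for i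
    using part[of i] pos nth_mem[of i l] by (fastforce simp: part_def split: if_splits)
  hence len: "length l = m" by (metis less_irrefl nat_neq_iff)
  thus "length l = length (rev [1..<Suc m])" by simp
  fix i assume "i < length l"
  thus "l ! i = rev [1..<Suc m] ! i"
    using part[of i] len by (auto simp: part_def rev_nth simp del: upt_Suc)
qed

lemma staircase_if_prod_nonzero:
  assumes "l \<in> partitions n"
    and "(\<Prod>u\<in>cells l. ((of_int (sp_content l u))\<^sup>2 - 1) / (of_int (hook_length l u))\<^sup>2) \<noteq> (0 :: rat)"
  obtains m where "l = rev [1..<Suc m]"
proof -
  from assms(1) have sorted: "sorted_wrt (\<ge>) l" and pos: "\<forall>x\<in>set l. 0 < x"
    by (auto simp: partitions_def)
  have no_unit: "sp_content l (i, j) \<notin> {1, -1}" if "(i, j) \<in> cells l" for i j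
  proof
    assume "sp_content l (i, j) \<in> {1, -1}"
    hence "((of_int (sp_content l (i, j)))\<^sup>2 - 1) / (of_int (hook_length l (i, j)))\<^sup>2 = (0 :: rat)"
      by auto
    with that have "(\<Prod>u\<in>cells l. ((of_int (sp_content l u))\<^sup>2 - 1) / (of_int (hook_length l u))\<^sup>2) = (0 :: rat)"
      by (intro prod_zero[OF finite_cells]) blast
    with assms(2) show False by contradiction
  qed
  have "\<exists>m. \<forall>i. part l (Suc i) = m - i"
  proof (rule staircase_if_no_unit_content[where p' = "\<lambda>j. conj_part l (Suc j)"])
    fix i j
    show "j < part l (Suc i) \<longleftrightarrow> i < conj_part l (Suc j)"
      using le_part_iff_le_conj_part[OF sorted, of "Suc i" "Suc j"] by (simp add: Suc_le_eq)
    assume "j < part l (Suc i)"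
    hence "(Suc i, Suc j) \<in> cells l" by (auto simp: cells_def part_def split: if_splits)
    \<comment> \<open>Numbering from 0 turns the summand 2 of the lower contents into 0 and the
      summand 0 of the upper ones into 2.\<close>
    from no_unit[OF this]
    show "(if j < i then int (part l (Suc i)) + int (part l (Suc j)) - int i - int j
       else int i + int j + 2 - int (conj_part l (Suc i)) - int (conj_part l (Suc j))) \<notin> {1, -1}"
      by (auto simp: sp_content_def split: if_splits)
  qed
  with eq_staircaseI[OF pos] that show ?thesis by blast
qed

text \<open>The second factor at \<open>t\<close> and the first factor at \<open>t + 1\<close> are
  reciprocal. The first factor at 1 has exponent 0, so only the second factor at \<open>k\<close> is
  left.\<close>

lemma prod_neighbour_ratios:
  fixes h :: "nat \<Rightarrow> 'a :: field"
  assumes "\<And>t. h t \<noteq> 0"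
  shows "(\<Prod>t\<in>{1..k}. (h (t - 1) / h t) ^ (t div 2) * (h (t + 1) / h t) ^ ((t + 1) div 2))
    = (h (k + 1) / h k) ^ ((k + 1) div 2)"
proof (induction k)
  case (Suc k)
  have "(h (k + 1) / h k) ^ ((k + 1) div 2) * (h k / h (k + 1)) ^ ((k + 1) div 2) = 1"
    using assms by (simp flip: power_mult_distrib)
  with Suc show ?case by (simp add: mult.assoc[symmetric])
qed simp

text \<open>The exponents have the same parity: a triangular number grows by \<open>m + 1\<close>,
  and two consecutive halves add up to \<open>m + 1\<close>.\<close>

lemma power_minus_one_half: "(-1 :: 'a :: ring_1) ^ ((m + 1) div 2) = (-1) ^ (Suc m choose 2)"
proof -
  have "even ((m + 1) div 2) \<longleftrightarrow> even (Suc m choose 2)"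
  proof (induction m)
    case (Suc m)
    have "(Suc m + 1) div 2 + (m + 1) div 2 = Suc m" by linarith
    hence "even ((Suc m + 1) div 2) \<longleftrightarrow> (even ((m + 1) div 2) \<longleftrightarrow> even (Suc m))"
      by (metis even_add)
    moreover have "Suc (Suc m) choose 2 = Suc m + (Suc m choose 2)"
      by (simp add: numeral_2_eq_2)
    ultimately show ?case using Suc by (metis even_add)
  qed (simp add: choose_two)
  thus ?thesis by (simp add: minus_one_power_iff)
qed

lemma prod_staircase:
  defines "l \<equiv> \<lambda>m. rev [1..<Suc m]"
  shows "(\<Prod>u\<in>cells (l m). ((of_int (sp_content (l m) u))\<^sup>2 - 1) / (of_int (hook_length (l m) u))\<^sup>2)
    = (-1 :: rat) ^ (Suc m choose 2)"
proof -
  define f :: "nat \<times> nat \<Rightarrow> rat" where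
    "f u = ((of_int (sp_content (l m) u))\<^sup>2 - 1) / (of_int (hook_length (l m) u))\<^sup>2" for u
  \<comment> \<open>\<open>h t\<close> is the hook length on the antidiagonal
    \<open>i + j = t + 1\<close>. Integer subtraction gives it a value just outside the diagram too:
    \<open>h (m + 1) = -1\<close> is the source of the sign.\<close>
  define h :: "nat \<Rightarrow> rat" where "h t = of_int (2 * (int m - int t) + 1)" for t
  have part: "part (l m) i = m + 1 - i" if "1 \<le> i" for i
    using that unfolding l_def by (rule part_staircase)
  have conj: "conj_part (l m) i = m + 1 - i" if "1 \<le> i" for i
    using that unfolding l_def by (rule conj_part_staircase)
  have "length (l m) = m" by (simp add: l_def)
  hence cells: "cells (l m) = {(i, j). 1 \<le> i \<and> 1 \<le> j \<and> i + j \<le> m + 1}"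
    by (auto simp: cells_def part)
  have h0: "h t \<noteq> 0" for t
    unfolding h_def of_int_eq_0_iff by presburger
  have f: "f (i, t + 1 - i) = (if t + 1 < 2 * i then h (t - 1) / h t else h (t + 1) / h t)"
    if t: "t \<in> {1..m}" and i: "i \<in> {1..t}" for t i
  proof -
    let ?j = "t + 1 - i"
    have "1 \<le> i" "1 \<le> ?j" using i by auto
    note parts = part[OF this(1)] part[OF this(2)] conj[OF this(1)] conj[OF this(2)]
    have "hook_length (l m) (i, ?j) = 2 * (int m - int t) + 1"
      using t i parts by (simp add: hook_length_def)
    hence H: "of_int (hook_length (l m) (i, ?j)) = h t" by (simp add: h_def)
    \<comment> \<open>The content \<open>c\<close> is even, and \<open>c - 1\<close> and
      \<open>c + 1\<close> are up to sign two neighbouring values of \<open>h\<close>, one of them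
      \<open>h t\<close>.\<close>
    have S: "(of_int (sp_content (l m) (i, ?j)))\<^sup>2 - 1 =
      h t * (if t + 1 < 2 * i then h (t - 1) else h (t + 1))"
    proof (cases "t + 1 < 2 * i")
      case True
      have c: "sp_content (l m) (i, ?j) = 2 * (int m - int t) + 2"
        proof -
        have "?j < i" using True i by auto
        hence "sp_content (l m) (i, ?j) = int (part (l m) i) + int (part (l m) ?j) - int i - int ?j + 2"
          unfolding sp_content_def by simp
        thus ?thesis unfolding parts using t i by simp
      qed
      show ?thesis unfolding c using True t
        by (simp add: h_def of_nat_diff power2_eq_square algebra_simps)
    next
      case False
      have c: "sp_content (l m) (i, ?j) = - (2 * (int m - int t))"
        proof -
        have "\<not> ?j < i" using False i by auto
        hence "sp_content (l m) (i, ?j) = int i + int ?j - int (conj_part (l m) i) - int (conj_part (l m) ?j)"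
          unfolding sp_content_def by simp
        thus ?thesis unfolding parts using t i by simp
      qed
      show ?thesis unfolding c using False t
        by (simp add: h_def power2_eq_square algebra_simps)
    qed
    show ?thesis unfolding f_def H S using h0[of t] by (simp add: power2_eq_square)
  qed
  have "(\<Prod>u\<in>cells (l m). f u) = (\<Prod>(t, i)\<in>Sigma {1..m} (\<lambda>t. {1..t}). f (i, t + 1 - i))"
    by (rule prod.reindex_bij_witness[where j = "\<lambda>(i, j). (i + j - 1, i)" and i = "\<lambda>(t, i). (i, t + 1 - i)"])
       (auto simp: cells)
  also have "\<dots> = (\<Prod>t\<in>{1..m}. \<Prod>i\<in>{1..t}. f (i, t + 1 - i))"
    by (rule prod.Sigma[symmetric]) auto
  also have "\<dots> = (\<Prod>t\<in>{1..m}. (h (t - 1) / h t) ^ (t div 2) * (h (t + 1) / h t) ^ ((t + 1) div 2))"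
  proof (rule prod.cong[OF refl])
    fix t assume t: "t \<in> {1..m}"
    \<comment> \<open>Of the \<open>t\<close> cells of the antidiagonal, \<open>t div 2\<close> lie
      strictly below the diagonal; a diagonal cell belongs to the other half.\<close>
    have "{i \<in> {1..t}. t + 1 < 2 * i} = {(t + 1) div 2<..t}" by auto
    moreover have "{i \<in> {1..t}. \<not> t + 1 < 2 * i} = {1..(t + 1) div 2}" by auto
    moreover have "t - (t + 1) div 2 = t div 2" by linarith
    moreover have "(\<Prod>i\<in>{1..t}. f (i, t + 1 - i)) =
      (\<Prod>i\<in>{1..t}. if t + 1 < 2 * i then h (t - 1) / h t else h (t + 1) / h t)"
      using f[OF t] by (intro prod.cong) auto
    ultimately show "(\<Prod>i\<in>{1..t}. f (i, t + 1 - i)) =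
      (h (t - 1) / h t) ^ (t div 2) * (h (t + 1) / h t) ^ ((t + 1) div 2)"
      by (simp add: prod.If_cases Int_def Collect_neg_eq[symmetric] conj_commute)
  qed
  also have "\<dots> = (h (m + 1) / h m) ^ ((m + 1) div 2)"
    using h0 by (rule prod_neighbour_ratios)
  also have "h (m + 1) / h m = -1" by (simp add: h_def)
  finally show ?thesis unfolding f_def by (simp only: power_minus_one_half)
qed

section \<open>Gauss's identity for triangular numbers\<close>

text \<open>The left-hand side for \<open>n + 1\<close> differs from that for \<open>n\<close> by a telescoping sum.\<close>

lemma shanks_identity:
  fixes x :: "'a :: comm_ring_1"
  assumes v: "\<And>r. v r * (1 - x ^ (2 * r + 1)) = 1"
  shows "(\<Sum>s<n. (\<Prod>r\<in>{s..<n}. (1 - x ^ (2 * r + 2)) * v r) * x ^ (s * (2 * n + 1)))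
    = (\<Sum>i<2 * n. x ^ (Suc i choose 2))"
proof (induction n)
  case (Suc n)
  define G where "G s n = (\<Prod>r\<in>{s..<n}. (1 - x ^ (2 * r + 2)) * v r)" for s n
  \<comment> \<open>\<open>U\<close> is an antidifference in \<open>s\<close> of the change of the
    summand from \<open>n\<close> to \<open>n + 1\<close>. Its factor \<open>1 - x ^ (2 * s)\<close>
    makes \<open>U 0\<close> vanish.\<close>
  define U where "U s = x ^ (s * (2 * n + 1)) * (1 - x ^ (2 * s)) * G s n * v n" for s
  have step: "G s (Suc n) * x ^ (s * (2 * Suc n + 1)) = G s n * x ^ (s * (2 * n + 1)) + (U (Suc s) - U s)"
    if "s < n" for s
  proof -
    define y a b where "y = x ^ (s * (2 * n + 1))" and "a = x ^ (2 * s)" and "b = x ^ (2 * n + 1)"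
    have "G s n = (1 - x ^ (2 * s + 2)) * v s * G (Suc s) n"
      using that unfolding G_def by (simp add: prod.atLeast_Suc_lessThan)
    hence "(1 - x ^ (2 * s + 1)) * G s n = (v s * (1 - x ^ (2 * s + 1))) * ((1 - x ^ (2 * s + 2)) * G (Suc s) n)"
      by (simp only: mult_ac)
    hence "(1 - x ^ (2 * s + 2)) * G (Suc s) n = (1 - x ^ (2 * s + 1)) * G s n"
      unfolding v by simp
    hence "(1 - x ^ (2 * s + 2)) * G (Suc s) n = (1 - a * x) * G s n"
      by (simp add: a_def mult_ac)
    moreover have "U (Suc s) = y * b * ((1 - x ^ (2 * s + 2)) * G (Suc s) n) * v n"
      unfolding U_def y_def b_def by (simp add: power_add mult_ac)
    ultimately have U1: "U (Suc s) = y * b * ((1 - a * x) * G s n) * v n" by simp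
    have G: "G s (Suc n) = G s n * ((1 - b * x) * v n)"
      using that unfolding G_def b_def by (simp add: mult_ac)
    have x: "x ^ (s * (2 * Suc n + 1)) = y * a"
      unfolding y_def a_def by (simp add: algebra_simps flip: power_add)
    have U0: "U s = y * (1 - a) * G s n * v n" by (simp add: U_def y_def a_def)
    \<comment> \<open>Inserting \<open>v n * (1 - b) = 1\<close> puts \<open>v n\<close> into every
      term; the rest is
      \<open>(1 - b) + b * (1 - a * x) - (1 - a) = a * (1 - b * x)\<close>.\<close>
    have "G s n * y + (U (Suc s) - U s) = G s n * y * (v n * (1 - b)) + (U (Suc s) - U s)"
      using v by (simp add: b_def)
    also have "\<dots> = G s (Suc n) * (y * a)"
      unfolding G U0 U1 by (simp add: algebra_simps)
    finally show ?thesis unfolding x y_def[symmetric] by simp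
  qed
  have "(\<Sum>s<Suc n. G s (Suc n) * x ^ (s * (2 * Suc n + 1)))
    = (\<Sum>s<n. G s n * x ^ (s * (2 * n + 1)) + (U (Suc s) - U s)) + G n (Suc n) * x ^ (n * (2 * Suc n + 1))"
    using step by simp
  also have "\<dots> = (\<Sum>s<n. G s n * x ^ (s * (2 * n + 1))) + (U n - U 0 + G n (Suc n) * x ^ (n * (2 * Suc n + 1)))"
    by (simp only: sum.distrib sum_lessThan_telescope add.assoc)
  \<comment> \<open>The boundary term and the new summand \<open>s = n\<close> together give the
    next two triangular powers.\<close>
  also have "U n - U 0 + G n (Suc n) * x ^ (n * (2 * Suc n + 1)) = x ^ (n * (2 * n + 1)) * (1 + x ^ (2 * n + 1))"
  proof -
    define y a where "y = x ^ (n * (2 * n + 1))" and "a = x ^ (2 * n)"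
    have U: "U n = y * (1 - a) * v n" "U 0 = 0" by (simp_all add: U_def G_def y_def a_def)
    have x: "x ^ (n * (2 * Suc n + 1)) = y * a"
      unfolding y_def a_def by (simp add: algebra_simps flip: power_add)
    have G: "G n (Suc n) = (1 - a * x * x) * v n" by (simp add: G_def a_def mult_ac)
    have "U n - U 0 + G n (Suc n) * x ^ (n * (2 * Suc n + 1)) = y * (1 + a * x) * (v n * (1 - a * x))"
      unfolding U x G by (simp add: algebra_simps)
    also have "v n * (1 - a * x) = 1" using v[of n] by (simp add: a_def mult_ac)
    finally show ?thesis by (simp add: y_def a_def mult_ac)
  qed
  also have "\<dots> = x ^ (Suc (2 * n) choose 2) + x ^ (Suc (Suc (2 * n)) choose 2)"
  proof -
    have "Suc (2 * n) choose 2 = n * (2 * n + 1)" by (simp add: choose_two)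
    moreover have "Suc (Suc (2 * n)) choose 2 = n * (2 * n + 1) + (2 * n + 1)"
      by (simp add: choose_two algebra_simps)
    ultimately show ?thesis by (simp only: power_add distrib_left mult_1_right)
  qed
  finally show ?case
    using Suc unfolding G_def by (simp add: add.assoc)
qed simp

section \<open>From the finite identity to the infinite product\<close>

lemma dvd_prod_minus_one:
  fixes d :: "'a :: comm_ring_1"
  assumes "\<And>k. k \<in> K \<Longrightarrow> d dvd f k - 1"
  shows "d dvd prod f K - 1"
  using assms
proof (induction K rule: infinite_finite_induct)
  case (insert k K)
  have "f k * prod f K - 1 = f k * (prod f K - 1) + (f k - 1)" by (simp add: algebra_simps)
  moreover have "d dvd f k * (prod f K - 1) + (f k - 1)"
    using insert by (intro dvd_add dvd_mult) auto
  ultimately have "d dvd f k * prod f K - 1" by metis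
  with insert.hyps show ?case by simp
qed simp_all

lemma fps_nth_eq_if_dvd_diff:
  assumes "fps_X ^ n dvd f - g" "d < n"
  shows "fps_nth f d = fps_nth (g :: 'a :: comm_ring_1 fps) d"
proof -
  from assms(1) obtain u where "f - g = fps_X ^ n * u" by (rule dvdE)
  hence "fps_nth (f - g) d = 0" using assms(2) by (simp add: fps_X_power_mult_nth)
  thus ?thesis by simp
qed

lemma prod_lessThan_double:
  fixes f :: "nat \<Rightarrow> 'a :: comm_monoid_mult"
  shows "prod f {..<2 * n} = (\<Prod>k<n. f (2 * k) * f (2 * k + 1))"
  by (induction n) (simp_all add: mult_ac)

lemma fps_divide_mult_cancel:
  fixes f g :: "'a :: field fps"
  assumes "fps_nth g 0 \<noteq> 0"
  shows "f / g * g = f"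
  using assms by (simp add: fps_divide_unit inverse_mult_eq_1 mult.assoc)

text \<open>At \<open>x = - q\<close>, the term \<open>s = 0\<close> of Shanks's sum is the partial
  product times \<open>D\<close>, which cancels the denominators with \<open>k \<ge> n\<close>.
  Modulo \<open>q ^ (2 * n + 1)\<close>, \<open>D\<close> is 1 and the terms with
  \<open>s \<ge> 1\<close> vanish.\<close>

lemma gauss_product_dvd:
  fixes q :: "'a :: field fps"
  defines "q \<equiv> fps_X"
  defines "B \<equiv> \<lambda>k. (1 - q ^ (k + 1)) / (1 - q ^ (4 * k + 2))"
  assumes "0 < n"
  shows "q ^ (2 * n + 1) dvd prod B {..<2 * n} - (\<Sum>i<2 * n. (- q) ^ (Suc i choose 2))"
proof -
  define x where "x = - q"
  define v where "v r = inverse (1 - x ^ (2 * r + 1))" for r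
  have v: "v r * (1 - x ^ (2 * r + 1)) = 1" for r
    unfolding v_def by (rule inverse_mult_eq_1) (simp add: x_def q_def)
  define G where "G s = (\<Prod>r\<in>{s..<n}. (1 - x ^ (2 * r + 2)) * v r)" for s
  define D where "D = (\<Prod>k\<in>{n..<2 * n}. 1 - q ^ (4 * k + 2))"
  define E where "E = (\<Prod>k<n. 1 - q ^ (4 * k + 2))"
  have "E \<noteq> 0"
  proof -
    have "1 - q ^ (4 * k + 2) \<noteq> 0" for k
    proof
      assume "1 - q ^ (4 * k + 2) = 0"
      hence "fps_nth (1 - q ^ (4 * k + 2)) 0 = 0" by simp
      thus False by (simp add: q_def)
    qed
    thus ?thesis by (simp add: E_def)
  qed
  have "prod B {..<2 * n} * D * E = prod B {..<2 * n} * (\<Prod>k<2 * n. 1 - q ^ (4 * k + 2))"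
  proof -
    have "{..<2 * n} = {..<n} \<union> {n..<2 * n}" by auto
    hence "(\<Prod>k<2 * n. 1 - q ^ (4 * k + 2)) = E * D"
      unfolding D_def E_def by (simp add: prod.union_disjoint ivl_disj_int)
    thus ?thesis by (simp add: mult_ac)
  qed
  also have "\<dots> = (\<Prod>k<2 * n. 1 - q ^ (k + 1))"
    unfolding prod.distrib[symmetric] B_def
    by (intro prod.cong refl fps_divide_mult_cancel) (simp add: q_def)
  also have "\<dots> = (\<Prod>k<n. (1 - q ^ (2 * k + 1)) * (1 - q ^ (2 * k + 2)))"
    unfolding prod_lessThan_double by simp
  also have "\<dots> = (\<Prod>k<n. (1 - x ^ (2 * k + 2)) * v k * (1 - q ^ (4 * k + 2)))"
  proof (rule prod.cong[OF refl])
    fix k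
    \<comment> \<open>At odd exponents \<open>x = - q\<close> changes the sign, so
      \<open>v k\<close> inverts \<open>1 + a\<close> and \<open>1 - a\<close> becomes
      \<open>v k * (1 - a * a)\<close>.\<close>
    define a where "a = q ^ (2 * k + 1)"
    have "v k * (1 + a) = 1" using v[of k] by (simp add: x_def a_def)
    hence "(1 - a) * (1 - q ^ (2 * k + 2)) = (1 - q ^ (2 * k + 2)) * (v k * (1 + a)) * (1 - a)"
      by simp
    also have "\<dots> = (1 - q ^ (2 * k + 2)) * v k * (1 - a * a)"
      by (simp add: algebra_simps)
    also have "a * a = q ^ (4 * k + 2)" by (simp add: a_def flip: power_add)
    also have "q ^ (2 * k + 2) = x ^ (2 * k + 2)" by (simp add: x_def)
    finally show "(1 - q ^ (2 * k + 1)) * (1 - q ^ (2 * k + 2)) =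
      (1 - x ^ (2 * k + 2)) * v k * (1 - q ^ (4 * k + 2))"
      by (simp add: a_def x_def)
  qed
  also have "\<dots> = G 0 * E"
    by (simp add: prod.distrib G_def E_def atLeast0LessThan)
  finally have BD: "prod B {..<2 * n} * D = G 0" using \<open>E \<noteq> 0\<close> by simp
  have "q ^ (2 * n + 1) dvd D - 1"
    unfolding D_def by (rule dvd_prod_minus_one) (simp add: dvd_diff_commute[of _ _ 1] le_imp_power_dvd)
  moreover have "q ^ (2 * n + 1) dvd G 0 - (\<Sum>i<2 * n. (- q) ^ (Suc i choose 2))"
  proof -
    have "(\<Sum>i<2 * n. x ^ (Suc i choose 2)) = (\<Sum>s<n. G s * x ^ (s * (2 * n + 1)))"
      unfolding G_def by (rule shanks_identity[OF v, symmetric])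
    also have "\<dots> = G 0 + (\<Sum>s\<in>{1..<n}. G s * x ^ (s * (2 * n + 1)))"
      using assms(3) by (simp add: sum.atLeast_Suc_lessThan flip: atLeast0LessThan)
    finally have "G 0 - (\<Sum>i<2 * n. x ^ (Suc i choose 2)) = - (\<Sum>s\<in>{1..<n}. G s * x ^ (s * (2 * n + 1)))"
      by simp
    moreover have "q ^ (2 * n + 1) dvd x ^ (s * (2 * n + 1))" if "1 \<le> s" for s
    proof -
      have "q ^ (2 * n + 1) dvd q ^ (s * (2 * n + 1))"
        using mult_le_mono1[OF that, of "2 * n + 1"] by (intro le_imp_power_dvd) simp
      thus ?thesis unfolding x_def power_minus[of q] by (rule dvd_mult)
    qed
    ultimately show ?thesis
      unfolding x_def by (auto intro!: dvd_sum dvd_mult)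
  qed
  \<comment> \<open>As \<open>G 0\<close> is the partial product times \<open>D\<close>, subtracting
    the partial product times \<open>D - 1\<close> leaves the partial product itself.\<close>
  ultimately have "q ^ (2 * n + 1) dvd (G 0 - (\<Sum>i<2 * n. (- q) ^ (Suc i choose 2))) - prod B {..<2 * n} * (D - 1)"
    by (metis dvd_diff dvd_mult)
  thus ?thesis unfolding BD[symmetric] by (simp add: algebra_simps)
qed

text \<open>The factor \<open>B m\<close> is 1 modulo \<open>q ^ (m + 1)\<close>, so factors from
  index \<open>n\<close> on do not affect coefficients below \<open>n\<close>.\<close>

lemma gauss_product_stable:
  fixes q :: "'a :: field fps"
  defines "q \<equiv> fps_X"
  defines "B \<equiv> \<lambda>k. (1 - q ^ (k + 1)) / (1 - q ^ (4 * k + 2))"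
  assumes "d < n" "n \<le> m"
  shows "fps_nth (prod B {..<m}) d = fps_nth (prod B {..<n}) d"
  using assms(4)
proof (induction rule: dec_induct)
  case (step m)
  define v where "v = inverse (1 - q ^ (4 * m + 2))"
  have "1 = (1 - q ^ (4 * m + 2)) * v"
    unfolding v_def by (rule inverse_mult_eq_1'[symmetric]) (simp add: q_def)
  moreover have "B m = (1 - q ^ (m + 1)) * v"
    unfolding B_def v_def by (rule fps_divide_unit) (simp add: q_def)
  moreover have "q ^ (4 * m + 2) = q ^ (m + 1) * q ^ (3 * m + 1)"
    by (simp flip: power_add)
  ultimately have "B m - 1 = (1 - q ^ (m + 1)) * v - (1 - q ^ (m + 1) * q ^ (3 * m + 1)) * v"
    by metis
  also have "\<dots> = q ^ (m + 1) * ((q ^ (3 * m + 1) - 1) * v)"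
    by (simp only: left_diff_distrib right_diff_distrib mult_ac) simp
  finally have "B m - 1 = q ^ (m + 1) * ((q ^ (3 * m + 1) - 1) * v)" .
  moreover have "prod B {..<Suc m} - prod B {..<m} = (B m - 1) * prod B {..<m}"
    by (simp add: algebra_simps)
  ultimately have "q ^ (m + 1) dvd prod B {..<Suc m} - prod B {..<m}"
    by (simp only: dvd_mult2 dvd_triv_left)
  hence "fps_nth (prod B {..<Suc m}) d = fps_nth (prod B {..<m}) d"
    unfolding q_def by (rule fps_nth_eq_if_dvd_diff) (use assms(3) step in simp)
  with step show ?case by simp
qed simp

lemma gauss_raw_has_prod:
  fixes q L :: "'a :: field fps"
  defines "q \<equiv> fps_X"
  defines "B \<equiv> \<lambda>k. (1 - q ^ (k + 1)) / (1 - q ^ (4 * k + 2))"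
  assumes L: "(\<lambda>n. (- q) ^ (Suc n choose 2)) sums L"
  shows "raw_has_prod B 0 L"
proof -
  have lim: "(\<lambda>n. prod B {..<n}) \<longlonglongrightarrow> L"
    unfolding tendsto_fps_iff
  proof
    fix d
    have "\<forall>\<^sub>F n in sequentially. fps_nth (\<Sum>i<n. (- q) ^ (Suc i choose 2)) d = fps_nth L d"
      using L unfolding sums_def tendsto_fps_iff by blast
    then obtain M where M: "\<And>n. n \<ge> M \<Longrightarrow> fps_nth (\<Sum>i<n. (- q) ^ (Suc i choose 2)) d = fps_nth L d"
      unfolding eventually_sequentially by blast
    \<comment> \<open>Being larger than \<open>d\<close>, \<open>k\<close> allows both the stability
      and the congruence at \<open>2 * k\<close>; being larger than \<open>M\<close>, it lies where
      the partial sums have settled.\<close>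
    define k where "k = Suc (max d M)"
    have "fps_nth (prod B {..<n}) d = fps_nth L d" if "n \<ge> 2 * k" for n
    proof -
      have "fps_nth (prod B {..<n}) d = fps_nth (prod B {..<2 * k}) d"
        unfolding B_def q_def by (rule gauss_product_stable) (use that in \<open>auto simp: k_def\<close>)
      also have "\<dots> = fps_nth (\<Sum>i<2 * k. (- q) ^ (Suc i choose 2)) d"
        unfolding B_def q_def
        by (rule fps_nth_eq_if_dvd_diff[OF gauss_product_dvd]) (auto simp: k_def)
      also have "\<dots> = fps_nth L d" by (rule M) (simp add: k_def)
      finally show ?thesis .
    qed
    thus "\<forall>\<^sub>F n in sequentially. fps_nth (prod B {..<n}) d = fps_nth L d"
      unfolding eventually_sequentially by blast
  qed
  \<comment> \<open>\<open>raw_has_prod\<close> demands a nonzero limit; all partial products have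
    constant coefficient 1.\<close>
  have "fps_nth L 0 \<noteq> 0"
  proof -
    have "\<forall>\<^sub>F n in sequentially. fps_nth (prod B {..<n}) 0 = fps_nth L 0"
      using lim unfolding tendsto_fps_iff by blast
    moreover have "fps_nth (prod B {..<n}) 0 = 1" for n
      by (induction n) (simp_all add: B_def q_def)
    ultimately show ?thesis by simp
  qed
  hence "L \<noteq> 0" by auto
  moreover have "(\<lambda>n. \<Prod>i\<le>n. B (i + 0)) \<longlonglongrightarrow> L"
    using LIMSEQ_Suc[OF lim] by (simp add: lessThan_Suc_atMost)
  ultimately show ?thesis unfolding raw_has_prod_def by blast
qed

section \<open>The hook formula\<close>

theorem theorem2p15:
  defines "q \<equiv> (fps_X :: rat fps)"
  defines "A \<equiv> (\<lambda>n. q ^ n * fps_const (\<Sum>l\<in>partitions n. \<Prod>u\<in>cells l.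
      ((of_int (sp_content l u))\<^sup>2 - 1) / (of_int (hook_length l u))\<^sup>2))"
  defines "B \<equiv> (\<lambda>k. let j = k + 1 in (1 - q ^ j) / (1 - q ^ (4 * j - 2)))"
  defines "C \<equiv> (\<lambda>n. (- q) ^ ((n + 1) choose 2))"
  shows "summable A \<and> convergent_prod B \<and> summable C \<and>
    (\<Sum>n. A n) = (\<Prod>k. B k) \<and> (\<Prod>k. B k) = (\<Sum>n. C n)"
proof -
  define w :: "nat list \<Rightarrow> rat" where
    "w l = (\<Prod>u\<in>cells l. ((of_int (sp_content l u))\<^sup>2 - 1) / (of_int (hook_length l u))\<^sup>2)" for l
  define a where "a n = (\<Sum>l\<in>partitions n. w l)" for n
  define T where "T m = Suc m choose 2" for m
  have A: "A n = fps_X ^ n * fps_const (a n)" for n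
    by (simp add: A_def a_def w_def q_def)
  have T: "strict_mono T"
    unfolding strict_mono_Suc_iff T_def by (simp add: numeral_2_eq_2)
  have sums: "A sums Abs_fps a"
    using fps_notation[of "Abs_fps a"] unfolding sums_def' A by (simp add: mult.commute)
  have nonzero: "\<exists>m. l = rev [1..<Suc m] \<and> n = T m" if "l \<in> partitions n" "w l \<noteq> 0" for l n
    using that sum_list_staircase unfolding w_def T_def
    by (metis (mono_tags, lifting) staircase_if_prod_nonzero partitions_def mem_Collect_eq)
  have "A n = 0" if "n \<notin> range T" for n
  proof -
    have "a n = 0"
      using nonzero[of _ n] that unfolding a_def by (intro sum.neutral) blast
    thus ?thesis by (simp add: A)
  qed
  \<comment> \<open>Terms off the triangular numbers vanish, so the series may be summed along
    \<open>T\<close> alone.\<close>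
  with sums_mono_reindex[OF T, of A] sums have sums_AT: "(\<lambda>m. A (T m)) sums Abs_fps a" by blast
  have "a (T m) = (-1) ^ T m" for m
  proof -
    have "a (T m) = sum w {rev [1..<Suc m]}"
      unfolding a_def
    proof (rule sum.mono_neutral_right[OF finite_partitions])
      show "{rev [1..<Suc m]} \<subseteq> partitions (T m)"
        using staircase_in_partitions unfolding T_def by simp
      show "\<forall>l\<in>partitions (T m) - {rev [1..<Suc m]}. w l = 0"
      proof (rule ballI)
        fix l assume l: "l \<in> partitions (T m) - {rev [1..<Suc m]}"
        show "w l = 0"
        proof (rule ccontr)
          assume "w l \<noteq> 0"
          with l nonzero[of l "T m"] obtain k where "l = rev [1..<Suc k]" "T m = T k" by auto
          \<comment> \<open>Staircases of different sizes have different sums, so \<open>T m\<close>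
            has just one staircase.\<close>
          with l strict_mono_eq[OF T] show False by (simp del: upt_Suc)
        qed
      qed
    qed
    thus ?thesis unfolding T_def w_def using prod_staircase[of m] by simp
  qed
  hence "A (T m) = C m" for m
    unfolding A C_def q_def T_def power_minus[of fps_X]
    by (simp add: mult.commute minus_one_power_iff flip: fps_const_neg)
  \<comment> \<open>Both series thus have the limit \<open>Abs_fps a\<close>, which Gauss's identity
    then makes the value of the product.\<close>
  with sums_AT have C: "C sums Abs_fps a" by simp
  have "B = (\<lambda>k. (1 - q ^ (k + 1)) / (1 - q ^ (4 * k + 2)))"
    by (simp add: B_def Let_def)
  hence prod: "raw_has_prod B 0 (Abs_fps a)"
    using gauss_raw_has_prod[of "Abs_fps a"] C unfolding C_def q_def by simp
  hence "prodinf B = Abs_fps a"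
    by (intro has_prod_unique[symmetric]) (simp add: has_prod_def)
  moreover have "convergent_prod B"
    using prod unfolding convergent_prod_def by blast
  ultimately show ?thesis
    using sums C by (simp add: sums_iff)
qed

end
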